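(* Let $Q$ be an FG-quasigroup, let $\alpha,\beta:Q\to Q$ be given by $x\,\alpha(x)=x=\beta(x)\,x$, and let $$M(Q)=\{a\in Q:\ xa\cdot yx = xy\cdot ax\ \text{ for all } x,y\in Q\}.$$ Then $$\alpha(Q)\cup\beta(Q)\subseteq M(Q)=\{a\in Q:\ xa\cdot yz=xy\cdot az\ \text{ for all } x,y,z\in Q\},$$ $M(Q)$ is a medial, normal subquasigroup of $Q$, and the quotient $Q/M(Q)$ is a group.
   Context: A quasigroup is a non-empty set $Q$ with a binary operation (written multiplicatively) such that all left translations $L_a:x\mapsto ax$ and all right translations $R_a:x\mapsto xa$ are permutations of $Q$. Juxtaposition binds more tightly than $\cdot$, so $xy\cdot zw$ means $(xy)(zw)$. In a quasigroup the maps $\alpha,\beta:Q\to Q$ are defined by $x\,\alpha(x)=x=\beta(x)\,x$. $Q$ is a left F-quasigroup if $x\cdot yz = xy\cdot\alpha(x)z$ for all $x,y,z\in Q$; a right F-quasigroup if $zy\cdot x = z\beta(x)\cdot yx$ for all $x,y,z\in Q$; an F-quasigroup if it is both. A quasigroup $(Q,\cdot)$ is isotopic to a group $(G,+)$ if there are bijections $a,b,c:Q\to G$ with $c(xy)=a(x)+b(y)$ for all $x,y\in Q$. An FG-quasigroup is an F-quasigroup isotopic to a (possibly noncommutative) group. A quasigroup is medial if $xa\cdot by=xb\cdot ay$ for all its elements $x,y,a,b$. A normal congruence of a quasigroup $Q$ is an equivalence relation on $Q$ compatible with multiplication and with left and right division, so that the quotient is again a quasigroup; a subquasigroup $N$ of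 $Q$ is normal if it is a block of a normal congruence $\rho$ (which is then uniquely determined by $N$), and $Q/N$ denotes the quotient quasigroup $Q/\rho$. *)

theory Defs
  imports "HOL-Algebra.Group"
begin

record 'a magma = "'a partial_object" +
  qmult :: "'a \<Rightarrow> 'a \<Rightarrow> 'a"  (infixl \<open>\<odot>\<index>\<close> 70)

locale quasigroup =
  fixes Q :: "'a magma" (structure)
  assumes nonempty: "carrier Q \<noteq> {}"
    and left_translation: "a \<in> carrier Q \<Longrightarrow> bij_betw (\<lambda>x. a \<odot> x) (carrier Q) (carrier Q)"
    and right_translation: "a \<in> carrier Q \<Longrightarrow> bij_betw (\<lambda>x. x \<odot> a) (carrier Q) (carrier Q)"

definition ldiv :: "'a magma \<Rightarrow> 'a \<Rightarrow> 'a \<Rightarrow> 'a"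
  where "ldiv Q a b = (THE x. x \<in> carrier Q \<and> a \<odot>\<^bsub>Q\<^esub> x = b)"

definition rdiv :: "'a magma \<Rightarrow> 'a \<Rightarrow> 'a \<Rightarrow> 'a"
  where "rdiv Q b a = (THE x. x \<in> carrier Q \<and> x \<odot>\<^bsub>Q\<^esub> a = b)"

definition alpha :: "'a magma \<Rightarrow> 'a \<Rightarrow> 'a"
  where "alpha Q x = (THE u. u \<in> carrier Q \<and> x \<odot>\<^bsub>Q\<^esub> u = x)"

definition beta :: "'a magma \<Rightarrow> 'a \<Rightarrow> 'a"
  where "beta Q x = (THE u. u \<in> carrier Q \<and> u \<odot>\<^bsub>Q\<^esub> x = x)"

locale left_F_quasigroup = quasigroup +
  assumes left_F: "\<lbrakk>x \<in> carrier Q; y \<in> carrier Q; z \<in> carrier Q\<rbrakk>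
    \<Longrightarrow> x \<odot> (y \<odot> z) = (x \<odot> y) \<odot> (alpha Q x \<odot> z)"

locale right_F_quasigroup = quasigroup +
  assumes right_F: "\<lbrakk>x \<in> carrier Q; y \<in> carrier Q; z \<in> carrier Q\<rbrakk>
    \<Longrightarrow> (z \<odot> y) \<odot> x = (z \<odot> beta Q x) \<odot> (y \<odot> x)"

locale F_quasigroup = left_F_quasigroup + right_F_quasigroup

definition isotopic_to :: "'a magma \<Rightarrow> ('b, 'c) monoid_scheme \<Rightarrow> bool"
  where "isotopic_to Q G \<longleftrightarrow>
    (\<exists>a b c. bij_betw a (carrier Q) (carrier G) \<and> bij_betw b (carrier Q) (carrier G) \<and>
       bij_betw c (carrier Q) (carrier G) \<and>
       (\<forall>x\<in>carrier Q. \<forall>y\<in>carrier Q. c (x \<odot>\<^bsub>Q\<^esub> y) = a x \<otimes>\<^bsub>G\<^esub> b y))"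

text \<open>HOL has no existential quantification over types, so the group is sought on the
  element type of the quasigroup. This loses nothing: a group isotopic to \<open>Q\<close> is in
  bijection with \<open>carrier Q\<close>, so its structure can be transported there
  (\<open>FG_quasigroupI\<close> below).\<close>

locale FG_quasigroup = F_quasigroup Q for Q :: "'a magma" (structure) +
  assumes isotopic_group: "\<exists>G :: 'a monoid. group G \<and> isotopic_to Q G"

lemma FG_quasigroupI:
  fixes Q :: "'a magma" and G :: "('b, 'c) monoid_scheme"
  assumes "F_quasigroup Q" "group G" "isotopic_to Q G"
  shows "FG_quasigroup Q"
proof -
  interpret G: group G by fact
  from \<open>isotopic_to Q G\<close> obtain a b c where
      a: "bij_betw a (carrier Q) (carrier G)" and b: "bij_betw b (carrier Q) (carrier G)"
    and c: "bij_betw c (carrier Q) (carrier G)"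
    and iso: "\<forall>x\<in>carrier Q. \<forall>y\<in>carrier Q. c (x \<odot>\<^bsub>Q\<^esub> y) = a x \<otimes>\<^bsub>G\<^esub> b y"
    unfolding isotopic_to_def by blast
  define d where "d = the_inv_into (carrier Q) c"
  have d: "bij_betw d (carrier G) (carrier Q)"
    unfolding d_def using c by (rule bij_betw_the_inv_into)
  have cd: "c (d g) = g" if "g \<in> carrier G" for g
    unfolding d_def using c that by (meson bij_betw_def f_the_inv_into_f_bij_betw)
  have dc: "d (c x) = x" if "x \<in> carrier Q" for x
    unfolding d_def using c that by (meson bij_betw_def the_inv_into_f_f)
  have cin: "c x \<in> carrier G" if "x \<in> carrier Q" for x using c that bij_betwE by blast
  have din: "d g \<in> carrier Q" if "g \<in> carrier G" for g using d that bij_betwE by blast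
  define H :: "'a monoid" where
    "H = \<lparr>carrier = carrier Q, monoid.mult = (\<lambda>x y. d (c x \<otimes>\<^bsub>G\<^esub> c y)), one = d \<one>\<^bsub>G\<^esub>\<rparr>"
  have "group H"
  proof (rule groupI)
    fix x assume x: "x \<in> carrier H"
    have "d (inv\<^bsub>G\<^esub> c x) \<otimes>\<^bsub>H\<^esub> x = \<one>\<^bsub>H\<^esub>" using x by (simp add: H_def cin cd)
    moreover have "d (inv\<^bsub>G\<^esub> c x) \<in> carrier H" using x by (simp add: H_def cin din)
    ultimately show "\<exists>y\<in>carrier H. y \<otimes>\<^bsub>H\<^esub> x = \<one>\<^bsub>H\<^esub>" by blast
  qed (auto simp: H_def cin din cd dc G.m_assoc)
  moreover have "isotopic_to Q H"
    unfolding isotopic_to_def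
  proof (intro exI conjI ballI)
    show "bij_betw (d \<circ> a) (carrier Q) (carrier H)" "bij_betw (d \<circ> b) (carrier Q) (carrier H)"
      using a b d by (auto simp: H_def intro: bij_betw_trans)
    show "bij_betw id (carrier Q) (carrier H)" by (simp add: H_def)
    fix x y assume xy: "x \<in> carrier Q" "y \<in> carrier Q"
    interpret quasigroup Q
      using \<open>F_quasigroup Q\<close> by (simp add: F_quasigroup_def left_F_quasigroup_def)
    have "x \<odot>\<^bsub>Q\<^esub> y \<in> carrier Q" using left_translation xy bij_betwE by blast
    then have "x \<odot>\<^bsub>Q\<^esub> y = d (a x \<otimes>\<^bsub>G\<^esub> b y)" using iso xy dc by metis
    moreover have "a x \<in> carrier G" "b y \<in> carrier G" using a b xy bij_betwE by blast+
    ultimately show "id (x \<odot>\<^bsub>Q\<^esub> y) = (d \<circ> a) x \<otimes>\<^bsub>H\<^esub> (d \<circ> b) y" by (simp add: H_def cd)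
  qed
  ultimately show ?thesis
    using \<open>F_quasigroup Q\<close> by (auto simp: FG_quasigroup_def FG_quasigroup_axioms_def)
qed

definition medial :: "'a magma \<Rightarrow> bool"
  where "medial Q \<longleftrightarrow>
    (\<forall>x\<in>carrier Q. \<forall>y\<in>carrier Q. \<forall>a\<in>carrier Q. \<forall>b\<in>carrier Q.
      (x \<odot>\<^bsub>Q\<^esub> a) \<odot>\<^bsub>Q\<^esub> (b \<odot>\<^bsub>Q\<^esub> y) = (x \<odot>\<^bsub>Q\<^esub> b) \<odot>\<^bsub>Q\<^esub> (a \<odot>\<^bsub>Q\<^esub> y))"

definition subquasigroup :: "'a set \<Rightarrow> 'a magma \<Rightarrow> bool"
  where "subquasigroup N Q \<longleftrightarrow> N \<subseteq> carrier Q \<and> quasigroup (Q\<lparr>carrier := N\<rparr>)"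

definition normal_congruence :: "'a magma \<Rightarrow> ('a \<times> 'a) set \<Rightarrow> bool"
  where "normal_congruence Q \<rho> \<longleftrightarrow> equiv (carrier Q) \<rho> \<and>
    (\<forall>(x, x')\<in>\<rho>. \<forall>(y, y')\<in>\<rho>.
      (x \<odot>\<^bsub>Q\<^esub> y, x' \<odot>\<^bsub>Q\<^esub> y') \<in> \<rho> \<and>
      (ldiv Q x y, ldiv Q x' y') \<in> \<rho> \<and>
      (rdiv Q x y, rdiv Q x' y') \<in> \<rho>)"

definition normal_subquasigroup :: "'a set \<Rightarrow> 'a magma \<Rightarrow> bool"
  where "normal_subquasigroup N Q \<longleftrightarrow>
    subquasigroup N Q \<and> (\<exists>\<rho>. normal_congruence Q \<rho> \<and> N \<in> carrier Q // \<rho>)"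

definition congruence_of :: "'a magma \<Rightarrow> 'a set \<Rightarrow> ('a \<times> 'a) set"
  where "congruence_of Q N = (THE \<rho>. normal_congruence Q \<rho> \<and> N \<in> carrier Q // \<rho>)"

text \<open>For a normal congruence the union below is the single class
  \<open>\<rho> `` {x \<odot> y}\<close>, for any representatives \<open>x \<in> A\<close> and \<open>y \<in> B\<close>.\<close>

definition quotient_by :: "'a magma \<Rightarrow> ('a \<times> 'a) set \<Rightarrow> 'a set magma"
  where "quotient_by Q \<rho> =
    \<lparr>carrier = carrier Q // \<rho>, qmult = (\<lambda>A B. \<Union>x\<in>A. \<Union>y\<in>B. \<rho> `` {x \<odot>\<^bsub>Q\<^esub> y})\<rparr>"

definition quotient_quasigroup :: "'a magma \<Rightarrow> 'a set \<Rightarrow> 'a set magma"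
  where "quotient_quasigroup Q N = quotient_by Q (congruence_of Q N)"

lemma congruence_of_eq:
  fixes Q :: "'a magma" (structure)
  assumes "quasigroup Q" and \<rho>: "normal_congruence Q \<rho>" "N \<in> carrier Q // \<rho>"
  shows "congruence_of Q N = \<rho>"
proof -
  interpret quasigroup Q by fact
  have sub: "\<rho>1 \<subseteq> \<rho>2" if 1: "normal_congruence Q \<rho>1" "N \<in> carrier Q // \<rho>1"
    and 2: "normal_congruence Q \<rho>2" "N \<in> carrier Q // \<rho>2" for \<rho>1 \<rho>2
  proof clarify
    fix x y assume xy: "(x, y) \<in> \<rho>1"
    have e: "equiv (carrier Q) \<rho>1" "equiv (carrier Q) \<rho>2"
      using 1 2 by (auto simp: normal_congruence_def)
    obtain n where n: "n \<in> carrier Q" "N = \<rho>1 `` {n}" using 1(2) by (auto elim: quotientE)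
    have nN: "n \<in> N" using equiv_class_self[OF e(1) n(1)] n(2) by simp
    have xyc: "x \<in> carrier Q" "y \<in> carrier Q" using e(1) xy by (meson equiv_class_eq_iff)+
    obtain u where u: "u \<in> carrier Q" "u \<odot> n = x"
      using right_translation[OF n(1)] xyc(1) by (metis bij_betw_imp_surj_on imageE)
    obtain m where m: "m \<in> carrier Q" "u \<odot> m = y"
      using left_translation[OF u(1)] xyc(2) by (metis bij_betw_imp_surj_on imageE)
    have ld: "ldiv Q u (u \<odot> v) = v" if "v \<in> carrier Q" for v
      unfolding ldiv_def using left_translation[OF u(1)] that
      by (intro the_equality) (auto simp: bij_betw_def inj_on_def)
    have "(u, u) \<in> \<rho>1" using e(1) u(1) by (simp add: equiv_def refl_on_def)
    then have "(ldiv Q u x, ldiv Q u y) \<in> \<rho>1" using 1(1) xy by (fastforce simp: normal_congruence_def)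
    then have "(n, m) \<in> \<rho>1" using ld n(1) m(1) u(2) m(2) by metis
    then have "m \<in> N" using n(2) by blast
    then have "(n, m) \<in> \<rho>2" using e(2) 2(2) nN by (meson quotient_eq_iff)
    moreover have "(u, u) \<in> \<rho>2" using e(2) u(1) by (simp add: equiv_def refl_on_def)
    ultimately have "(u \<odot> n, u \<odot> m) \<in> \<rho>2" using 2(1) by (fastforce simp: normal_congruence_def)
    then show "(x, y) \<in> \<rho>2" using u(2) m(2) by simp
  qed
  show ?thesis
    unfolding congruence_of_def using \<rho> sub by (intro the_equality) blast+
qed

definition is_group :: "'a magma \<Rightarrow> bool"
  where "is_group Q \<longleftrightarrow>
    (\<exists>e. group \<lparr>carrier = carrier Q, monoid.mult = qmult Q, one = e\<rparr>)"

definition M :: "'a magma \<Rightarrow> 'a set"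
  where "M Q = {a \<in> carrier Q. \<forall>x\<in>carrier Q. \<forall>y\<in>carrier Q.
    (x \<odot>\<^bsub>Q\<^esub> a) \<odot>\<^bsub>Q\<^esub> (y \<odot>\<^bsub>Q\<^esub> x) = (x \<odot>\<^bsub>Q\<^esub> y) \<odot>\<^bsub>Q\<^esub> (a \<odot>\<^bsub>Q\<^esub> x)}"

end

theory Submission
  imports Defs "HOL-Algebra.Group_Action"
begin

text \<open>
  Write the group isotopic to \<open>Q\<close> additively. A bijection \<open>\<phi>\<close> from \<open>Q\<close> to the group satisfies
  \<open>\<phi>(xy) = A(\<phi> x) + B(\<phi> y)\<close> for permutations \<open>A\<close>, \<open>B\<close>. The left F-law splits \<open>B(y + w)\<close> into
  a part depending on \<open>y\<close> and a part depending on \<open>w\<close>, which forces \<open>B\<close> to be an automorphism up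
  to a translation; the right F-law does the same for \<open>A\<close>. Hence
  \<open>\<phi>(xy) = f(\<phi> x) + e + g(\<phi> y)\<close> with automorphisms \<open>f\<close>, \<open>g\<close> and a constant \<open>e\<close>. In this form
  the F-laws say (\<open>left_F_conjugation\<close>, \<open>right_F_conjugation\<close>) that \<open>f\<close> and \<open>g\<close> commute and that
  \<open>f v\<close>, \<open>g v\<close> and \<open>v\<close> always induce the same inner automorphism, that is, they agree modulo the
  centre.

  Now everything can be read off. After cancellation, the law \<open>xa\<cdot>yz = xy\<cdot>az\<close> becomes
  \<open>k + e + u = u + e + k\<close> with \<open>k = fg(\<phi> a)\<close> and \<open>u = fg(\<phi> y)\<close>. The elements \<open>x\<close> and \<open>z\<close> have
  disappeared, so it is the same to require it only for \<open>z = x\<close>. As \<open>u\<close> runs through the group,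
  the law says that \<open>e + k\<close> is central, or equivalently that \<open>e + \<phi> a\<close> is. On the other hand,
  since \<open>f\<close> and \<open>g\<close> are trivial modulo the centre, mapping \<open>x\<close> to the inner automorphism
  induced by \<open>e + \<phi> x\<close> is a homomorphism from \<open>Q\<close> to a group. Its kernel
  is \<open>M(Q)\<close>. For any homomorphism from a quasigroup to a group the kernel is a normal
  subquasigroup containing all \<open>\<alpha>(x)\<close> and \<open>\<beta>(x)\<close>, and the quotient by it is a group.
  Mediality of \<open>M(Q)\<close> is an instance of the law that describes its elements.
\<close>

section \<open>Inner automorphisms\<close>

context group
begin

text \<open>Congruence modulo the centre is expressed by equality of inner automorphisms, so that
  the group of all permutations of the carrier takes the place of the quotient by the centre. The
  restriction to the carrier makes the value an element of \<open>BijGroup\<close>.\<close>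

definition inner :: "'a \<Rightarrow> 'a \<Rightarrow> 'a"
  where "inner g = (\<lambda>h\<in>carrier G. g \<otimes> h \<otimes> inv g)"

lemma inner_hom: "group_hom G (BijGroup (carrier G)) inner"
  using action_by_conjugation unfolding group_action_def inner_def .

lemma inner_eqI:
  assumes "\<And>u. u \<in> carrier G \<Longrightarrow> v \<otimes> u \<otimes> inv v = w \<otimes> u \<otimes> inv w"
  shows "inner v = inner w"
  using assms by (auto simp: inner_def)

lemma inner_eq_one_iff:
  assumes v: "v \<in> carrier G"
  shows "inner v = \<one>\<^bsub>BijGroup (carrier G)\<^esub> \<longleftrightarrow> (\<forall>u\<in>carrier G. v \<otimes> u = u \<otimes> v)"
proof -
  have "inner v = \<one>\<^bsub>BijGroup (carrier G)\<^esub> \<longleftrightarrow> (\<forall>u\<in>carrier G. v \<otimes> u \<otimes> inv v = u)"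
    by (auto simp: inner_def BijGroup_def restrict_def fun_eq_iff)
  also have "\<dots> \<longleftrightarrow> (\<forall>u\<in>carrier G. v \<otimes> u = u \<otimes> v)"
    using v by (metis inv_solve_right' m_closed)
  finally show ?thesis .
qed

section \<open>Affine maps\<close>

text \<open>Replacing \<open>w\<close> by \<open>c\<inverse> \<otimes> w\<close> and \<open>y\<close> by \<open>y \<otimes> c\<close> in the hypothesis gives
  \<open>B (y \<otimes> w) = p \<otimes> B w\<close> with \<open>p\<close> independent of \<open>w\<close>; the case \<open>w = \<one>\<close> determines \<open>p\<close> as
  \<open>B y \<otimes> (B \<one>)\<inverse>\<close>. Then \<open>y \<mapsto> (B \<one>)\<inverse> \<otimes> B y\<close> is multiplicative.\<close>

lemma affine_left:
  assumes B: "bij_betw B (carrier G) (carrier G)" and c: "c \<in> carrier G"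
    and eq: "\<And>y. y \<in> carrier G \<Longrightarrow> \<exists>p\<in>carrier G. \<forall>w\<in>carrier G. B (y \<otimes> w) = p \<otimes> B (c \<otimes> w)"
  shows "\<exists>g\<in>iso G G. \<forall>y\<in>carrier G. B y = B \<one> \<otimes> g y"
proof -
  have Bin: "B y \<in> carrier G" if "y \<in> carrier G" for y using B that bij_betwE by blast
  have add: "B (y \<otimes> u) = B y \<otimes> inv B \<one> \<otimes> B u" if y: "y \<in> carrier G" and u: "u \<in> carrier G" for y u
  proof -
    obtain p where p: "p \<in> carrier G" "\<forall>w\<in>carrier G. B ((y \<otimes> c) \<otimes> w) = p \<otimes> B (c \<otimes> w)"
      using eq[of "y \<otimes> c"] y c by auto
    have "B ((y \<otimes> c) \<otimes> (inv c \<otimes> w)) = p \<otimes> B (c \<otimes> (inv c \<otimes> w))" if "w \<in> carrier G" for w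
      using p(2) c that by simp
    moreover have "(y \<otimes> c) \<otimes> (inv c \<otimes> w) = y \<otimes> w" "c \<otimes> (inv c \<otimes> w) = w" if "w \<in> carrier G" for w
      using c y that by (simp_all add: inv_solve_right r_cancel_one' flip: m_assoc) (simp add: m_assoc)
    ultimately have q: "B (y \<otimes> w) = p \<otimes> B w" if "w \<in> carrier G" for w
      using that by simp
    from q[of \<one>] have "p = B y \<otimes> inv B \<one>"
      using y p Bin by (simp add: m_assoc)
    then show ?thesis using q[OF u] by simp
  qed
  define g where "g = (\<lambda>y. inv B \<one> \<otimes> B y)"
  have "g \<in> hom G G" by (rule homI) (simp_all add: g_def Bin add m_assoc)
  moreover have "bij_betw g (carrier G) (carrier G)"
  proof -
    have "bij_betw (\<lambda>z. inv B \<one> \<otimes> z) (carrier G) (carrier G)"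
      by (rule bij_betw_byWitness[where f' = "\<lambda>z. B \<one> \<otimes> z"]) (auto simp: Bin simp flip: m_assoc)
    from bij_betw_trans[OF B this] show ?thesis by (simp add: g_def o_def)
  qed
  moreover have "B y = B \<one> \<otimes> g y" if "y \<in> carrier G" for y
    using that by (simp add: g_def Bin flip: m_assoc)
  ultimately show ?thesis unfolding iso_def by blast
qed

text \<open>The mirror image of the preceding lemma.\<close>

lemma affine_right:
  assumes A: "bij_betw A (carrier G) (carrier G)" and c: "c \<in> carrier G"
    and eq: "\<And>y. y \<in> carrier G \<Longrightarrow> \<exists>p\<in>carrier G. \<forall>w\<in>carrier G. A (w \<otimes> y) = A (w \<otimes> c) \<otimes> p"
  shows "\<exists>f\<in>iso G G. \<forall>y\<in>carrier G. A y = f y \<otimes> A \<one>"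
proof -
  have Ain: "A y \<in> carrier G" if "y \<in> carrier G" for y using A that bij_betwE by blast
  have add: "A (u \<otimes> y) = A u \<otimes> inv A \<one> \<otimes> A y" if y: "y \<in> carrier G" and u: "u \<in> carrier G" for y u
  proof -
    obtain p where p: "p \<in> carrier G" "\<forall>w\<in>carrier G. A (w \<otimes> (c \<otimes> y)) = A (w \<otimes> c) \<otimes> p"
      using eq[of "c \<otimes> y"] y c by auto
    have "A ((w \<otimes> inv c) \<otimes> (c \<otimes> y)) = A ((w \<otimes> inv c) \<otimes> c) \<otimes> p" if "w \<in> carrier G" for w
      using p(2) c that by simp
    moreover have "(w \<otimes> inv c) \<otimes> (c \<otimes> y) = w \<otimes> y" "(w \<otimes> inv c) \<otimes> c = w" if "w \<in> carrier G" for w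
      using c y that by (simp_all add: m_assoc) (simp flip: m_assoc)
    ultimately have q: "A (w \<otimes> y) = A w \<otimes> p" if "w \<in> carrier G" for w
      using that by simp
    from q[of \<one>] have "p = inv A \<one> \<otimes> A y"
      using y p Ain by (simp flip: m_assoc)
    then show ?thesis using q[OF u] u y by (simp add: Ain m_assoc)
  qed
  define f where "f = (\<lambda>y. A y \<otimes> inv A \<one>)"
  have "f \<in> hom G G" by (rule homI) (simp_all add: f_def Ain add m_assoc)
  moreover have "bij_betw f (carrier G) (carrier G)"
  proof -
    have "bij_betw (\<lambda>z. z \<otimes> inv A \<one>) (carrier G) (carrier G)"
      by (rule bij_betw_byWitness[where f' = "\<lambda>z. z \<otimes> A \<one>"]) (auto simp: Ain m_assoc)
    from bij_betw_trans[OF A this] show ?thesis by (simp add: f_def o_def)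
  qed
  moreover have "A y = f y \<otimes> A \<one>" if "y \<in> carrier G" for y
    using that by (simp add: f_def Ain m_assoc)
  ultimately show ?thesis unfolding iso_def by blast
qed

text \<open>Writing \<open>y' = A y\<close> and \<open>w = B z\<close>, the left F-law at a fixed \<open>x\<close>
  expresses \<open>B (y' \<otimes> w)\<close> as a factor depending on \<open>y'\<close> times \<open>B (A c \<otimes> w)\<close>. Here \<open>c\<close>
  corresponds to the element \<open>\<alpha>(x)\<close> of the quasigroup.\<close>

lemma left_F_affine:
  assumes A: "bij_betw A (carrier G) (carrier G)" and B: "bij_betw B (carrier G) (carrier G)"
    and x: "x \<in> carrier G" and c: "c \<in> carrier G"
    and left_F: "\<And>y z. \<lbrakk>y \<in> carrier G; z \<in> carrier G\<rbrakk> \<Longrightarrow>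
      A x \<otimes> B (A y \<otimes> B z) = A (A x \<otimes> B y) \<otimes> B (A c \<otimes> B z)"
  shows "\<exists>g\<in>iso G G. \<forall>y\<in>carrier G. B y = B \<one> \<otimes> g y"
proof (rule affine_left[OF B])
  have in_G: "A y \<in> carrier G" "B y \<in> carrier G" if "y \<in> carrier G" for y
    using A B that bij_betwE by blast+
  show "A c \<in> carrier G" using c in_G by blast
  fix y' assume "y' \<in> carrier G"
  then obtain y where y: "y \<in> carrier G" "y' = A y" using A by (metis bij_betw_imp_surj_on imageE)
  have "B (y' \<otimes> w) = (inv A x \<otimes> A (A x \<otimes> B y)) \<otimes> B (A c \<otimes> w)" if w: "w \<in> carrier G" for w
  proof -
    obtain z where z: "z \<in> carrier G" "w = B z" using B w by (metis bij_betw_imp_surj_on imageE)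
    have "(inv A x \<otimes> A (A x \<otimes> B y)) \<otimes> B (A c \<otimes> w) = inv A x \<otimes> (A x \<otimes> B (y' \<otimes> w))"
      unfolding y(2) z(2) left_F[OF y(1) z(1)] using x y z c by (simp add: in_G m_assoc)
    also have "\<dots> = B (y' \<otimes> w)"
      using x y z by (simp add: in_G flip: m_assoc)
    finally show ?thesis by simp
  qed
  then show "\<exists>p\<in>carrier G. \<forall>w\<in>carrier G. B (y' \<otimes> w) = p \<otimes> B (A c \<otimes> w)"
    using x y by (intro bexI[of _ "inv A x \<otimes> A (A x \<otimes> B y)"]) (auto simp: in_G)
qed

lemma right_F_affine:
  assumes A: "bij_betw A (carrier G) (carrier G)" and B: "bij_betw B (carrier G) (carrier G)"
    and x: "x \<in> carrier G" and c: "c \<in> carrier G"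
    and right_F: "\<And>y z. \<lbrakk>y \<in> carrier G; z \<in> carrier G\<rbrakk> \<Longrightarrow>
      A (A z \<otimes> B y) \<otimes> B x = A (A z \<otimes> B c) \<otimes> B (A y \<otimes> B x)"
  shows "\<exists>f\<in>iso G G. \<forall>y\<in>carrier G. A y = f y \<otimes> A \<one>"
proof (rule affine_right[OF A])
  have in_G: "A y \<in> carrier G" "B y \<in> carrier G" if "y \<in> carrier G" for y
    using A B that bij_betwE by blast+
  show "B c \<in> carrier G" using c in_G by blast
  fix y' assume "y' \<in> carrier G"
  then obtain y where y: "y \<in> carrier G" "y' = B y" using B by (metis bij_betw_imp_surj_on imageE)
  have "A (w \<otimes> y') = A (w \<otimes> B c) \<otimes> (B (A y \<otimes> B x) \<otimes> inv B x)" if w: "w \<in> carrier G" for w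
  proof -
    obtain z where z: "z \<in> carrier G" "w = A z" using A w by (metis bij_betw_imp_surj_on imageE)
    have "A (w \<otimes> B c) \<otimes> (B (A y \<otimes> B x) \<otimes> inv B x) = A (w \<otimes> y') \<otimes> B x \<otimes> inv B x"
      unfolding y(2) z(2) right_F[OF y(1) z(1)] using x y z c by (simp add: in_G m_assoc)
    also have "\<dots> = A (w \<otimes> y')"
      using x y z by (simp add: in_G m_assoc)
    finally show ?thesis by simp
  qed
  then show "\<exists>p\<in>carrier G. \<forall>w\<in>carrier G. A (w \<otimes> y') = A (w \<otimes> B c) \<otimes> p"
    using x y by (intro bexI[of _ "B (A y \<otimes> B x) \<otimes> inv B x"]) (auto simp: in_G)
qed

section \<open>The F-laws for a linear operation on a group\<close>

text \<open>Cancelling \<open>z\<close> from the left F-law leaves \<open>v \<otimes> g (f y) = f v \<otimes> f (g y) \<otimes> t\<close> with \<open>t\<close>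
  independent of \<open>y\<close>, and \<open>y = \<one>\<close> gives \<open>t = (f v)\<inverse> \<otimes> v\<close>. The case \<open>v = \<one>\<close> of the
  conclusion is commutation of \<open>f\<close> and \<open>g\<close>, after which the conclusion says that \<open>v\<close> and \<open>f v\<close>
  induce the same inner automorphism.\<close>

lemma left_F_conjugation:
  assumes f: "f \<in> hom G G" and g: "g \<in> hom G G" and e: "e \<in> carrier G"
    and x: "x \<in> carrier G" and c: "c \<in> carrier G"
    and left_F: "\<And>y z. \<lbrakk>y \<in> carrier G; z \<in> carrier G\<rbrakk> \<Longrightarrow>
      f x \<otimes> e \<otimes> g (f y \<otimes> e \<otimes> g z) = f (f x \<otimes> e \<otimes> g y) \<otimes> e \<otimes> g (f c \<otimes> e \<otimes> g z)"
    and y: "y \<in> carrier G" and v: "v = f x \<otimes> e"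
  shows "v \<otimes> g (f y) \<otimes> inv v = f v \<otimes> f (g y) \<otimes> inv f v"
proof -
  interpret f: group_hom G G f by unfold_locales (rule f)
  interpret g: group_hom G G g by unfold_locales (rule g)
  have v_in: "v \<in> carrier G" using v x e by simp
  define t where "t = e \<otimes> g (f c)"
  have t: "t \<in> carrier G" using c e by (simp add: t_def)
  have key: "v \<otimes> g (f y) = f v \<otimes> f (g y) \<otimes> t" if y: "y \<in> carrier G" for y
  proof -
    have "v \<otimes> g (f y) \<otimes> g e = f v \<otimes> f (g y) \<otimes> t \<otimes> g e"
      using left_F[OF y one_closed] x y c e v_in unfolding t_def by (simp add: v m_assoc)
    then show ?thesis using v_in t y e by simp
  qed
  have "t = inv f v \<otimes> v" using key[of \<one>] v_in t inv_solve_left[of t "f v" v] by simp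
  then have "v \<otimes> g (f y) = f v \<otimes> f (g y) \<otimes> inv f v \<otimes> v"
    using key[OF y] v_in y by (simp add: m_assoc)
  then show ?thesis using v_in y by (simp add: inv_solve_right')
qed

text \<open>The mirror image of the preceding lemma; the conjugations are therefore by inverses.\<close>

lemma right_F_conjugation:
  assumes f: "f \<in> hom G G" and g: "g \<in> hom G G" and e: "e \<in> carrier G"
    and x: "x \<in> carrier G" and c: "c \<in> carrier G"
    and right_F: "\<And>y z. \<lbrakk>y \<in> carrier G; z \<in> carrier G\<rbrakk> \<Longrightarrow>
      f (f z \<otimes> e \<otimes> g y) \<otimes> e \<otimes> g x = f (f z \<otimes> e \<otimes> g c) \<otimes> e \<otimes> g (f y \<otimes> e \<otimes> g x)"
    and y: "y \<in> carrier G" and v: "v = e \<otimes> g x"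
  shows "inv v \<otimes> f (g y) \<otimes> v = inv g v \<otimes> g (f y) \<otimes> g v"
proof -
  interpret f: group_hom G G f by unfold_locales (rule f)
  interpret g: group_hom G G g by unfold_locales (rule g)
  have v_in: "v \<in> carrier G" using v x e by simp
  define t where "t = f (g c) \<otimes> e"
  have t: "t \<in> carrier G" using c e by (simp add: t_def)
  have key: "f (g y) \<otimes> v = t \<otimes> (g (f y) \<otimes> g v)" if y: "y \<in> carrier G" for y
  proof -
    have "f e \<otimes> (f (g y) \<otimes> v) = f e \<otimes> (t \<otimes> (g (f y) \<otimes> g v))"
      using right_F[OF y one_closed] x y c e v_in unfolding t_def by (simp add: v m_assoc)
    then show ?thesis using v_in t y e by simp
  qed
  have "t = v \<otimes> inv g v" using key[of \<one>] v_in t inv_solve_right[of t v "g v"] by simp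
  then have "f (g y) \<otimes> v = v \<otimes> (inv g v \<otimes> g (f y) \<otimes> g v)"
    using key[OF y] v_in y by (simp add: m_assoc)
  then show ?thesis using v_in y by (simp add: m_assoc flip: inv_solve_left')
qed

text \<open>The constant \<open>e\<close> collects the translation parts of \<open>A\<close> and \<open>B\<close>. Because \<open>f\<close> and \<open>g\<close> are
  surjective, both \<open>f x \<otimes> e\<close> and \<open>e \<otimes> g x\<close> run through the whole group, so the two
  conjugation identities hold for every \<open>v\<close>.\<close>

lemma F_isotope_form:
  assumes A: "bij_betw A (carrier G) (carrier G)" and B: "bij_betw B (carrier G) (carrier G)"
    and left_F: "\<And>x. x \<in> carrier G \<Longrightarrow> \<exists>c\<in>carrier G. \<forall>y\<in>carrier G. \<forall>z\<in>carrier G.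
      A x \<otimes> B (A y \<otimes> B z) = A (A x \<otimes> B y) \<otimes> B (A c \<otimes> B z)"
    and right_F: "\<And>x. x \<in> carrier G \<Longrightarrow> \<exists>c\<in>carrier G. \<forall>y\<in>carrier G. \<forall>z\<in>carrier G.
      A (A z \<otimes> B y) \<otimes> B x = A (A z \<otimes> B c) \<otimes> B (A y \<otimes> B x)"
  obtains f g e where "f \<in> iso G G" "g \<in> iso G G" "e \<in> carrier G"
    and "\<And>x y. \<lbrakk>x \<in> carrier G; y \<in> carrier G\<rbrakk> \<Longrightarrow> A x \<otimes> B y = f x \<otimes> e \<otimes> g y"
    and "\<And>x. x \<in> carrier G \<Longrightarrow> f (g x) = g (f x)"
    and "\<And>x. x \<in> carrier G \<Longrightarrow> inner (f x) = inner x"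
    and "\<And>x. x \<in> carrier G \<Longrightarrow> inner (g x) = inner x"
proof -
  interpret I: group_hom G "BijGroup (carrier G)" inner by (rule inner_hom)
  have in_G: "A y \<in> carrier G" "B y \<in> carrier G" if "y \<in> carrier G" for y
    using A B that bij_betwE by blast+
  obtain g where g: "g \<in> iso G G" "\<And>y. y \<in> carrier G \<Longrightarrow> B y = B \<one> \<otimes> g y"
    using left_F[OF one_closed] left_F_affine[OF A B one_closed] by meson
  obtain f where f: "f \<in> iso G G" "\<And>y. y \<in> carrier G \<Longrightarrow> A y = f y \<otimes> A \<one>"
    using right_F[OF one_closed] right_F_affine[OF A B one_closed] by meson
  have fg_hom: "f \<in> hom G G" "g \<in> hom G G" using f g by (auto simp: iso_def)
  interpret f: group_hom G G f by unfold_locales (rule fg_hom)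
  interpret g: group_hom G G g by unfold_locales (rule fg_hom)
  have fg_surj: "f ` carrier G = carrier G" "g ` carrier G = carrier G"
    using f g by (auto simp: iso_def bij_betw_def)
  define e where "e = A \<one> \<otimes> B \<one>"
  have e: "e \<in> carrier G" by (simp add: e_def in_G)
  have AB: "A x \<otimes> B y = f x \<otimes> e \<otimes> g y" if "x \<in> carrier G" "y \<in> carrier G" for x y
    using that by (simp add: f(2)[of x] g(2)[of y] e_def in_G m_assoc)

  have L: "v \<otimes> g (f y) \<otimes> inv v = f v \<otimes> f (g y) \<otimes> inv f v"
    if v: "v \<in> carrier G" and y: "y \<in> carrier G" for v y
  proof -
    obtain x where x: "x \<in> carrier G" "v \<otimes> inv e = f x"
      using fg_surj(1) v e by (metis imageE inv_closed m_closed)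
    obtain c where c: "c \<in> carrier G" "\<forall>y\<in>carrier G. \<forall>z\<in>carrier G.
        A x \<otimes> B (A y \<otimes> B z) = A (A x \<otimes> B y) \<otimes> B (A c \<otimes> B z)"
      using left_F[OF x(1)] by blast
    show ?thesis
    proof (rule left_F_conjugation[OF fg_hom e x(1) c(1) _ y])
      show "v = f x \<otimes> e" using x v e by (simp add: m_assoc flip: x(2))
      fix y z assume "y \<in> carrier G" "z \<in> carrier G"
      then show "f x \<otimes> e \<otimes> g (f y \<otimes> e \<otimes> g z) = f (f x \<otimes> e \<otimes> g y) \<otimes> e \<otimes> g (f c \<otimes> e \<otimes> g z)"
        using c x e by (simp add: AB del: f.hom_mult g.hom_mult)
    qed
  qed
  have R: "inv v \<otimes> f (g y) \<otimes> v = inv g v \<otimes> g (f y) \<otimes> g v"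
    if v: "v \<in> carrier G" and y: "y \<in> carrier G" for v y
  proof -
    obtain x where x: "x \<in> carrier G" "inv e \<otimes> v = g x"
      using fg_surj(2) v e by (metis imageE inv_closed m_closed)
    obtain c where c: "c \<in> carrier G" "\<forall>y\<in>carrier G. \<forall>z\<in>carrier G.
        A (A z \<otimes> B y) \<otimes> B x = A (A z \<otimes> B c) \<otimes> B (A y \<otimes> B x)"
      using right_F[OF x(1)] by blast
    show ?thesis
    proof (rule right_F_conjugation[OF fg_hom e x(1) c(1) _ y])
      show "v = e \<otimes> g x" using x v e by (simp flip: x(2) m_assoc)
      fix y z assume "y \<in> carrier G" "z \<in> carrier G"
      then show "f (f z \<otimes> e \<otimes> g y) \<otimes> e \<otimes> g x = f (f z \<otimes> e \<otimes> g c) \<otimes> e \<otimes> g (f y \<otimes> e \<otimes> g x)"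
        using c x e by (simp add: AB del: f.hom_mult g.hom_mult)
    qed
  qed
  have comm: "f (g x) = g (f x)" if "x \<in> carrier G" for x
    using L[OF one_closed that] that by simp
  have fg_onto: "\<exists>y\<in>carrier G. u = f (g y)" if "u \<in> carrier G" for u
    using fg_surj that by (metis imageE)
  have inner_f: "inner (f v) = inner v" if v: "v \<in> carrier G" for v
    by (rule inner_eqI) (metis L[OF v] comm fg_onto)
  \<comment> \<open>The right F-law compares conjugation by the inverses of \<open>v\<close> and \<open>g v\<close>, so the homomorphism
    \<open>inner\<close> is used to invert.\<close>
  have inner_g: "inner (g v) = inner v" if v: "v \<in> carrier G" for v
  proof -
    have "inner (inv v) = inner (inv g v)"
    proof (rule inner_eqI)
      fix u assume "u \<in> carrier G"
      then obtain y where "y \<in> carrier G" "u = f (g y)" using fg_onto by blast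
      then show "inv v \<otimes> u \<otimes> inv (inv v) = inv g v \<otimes> u \<otimes> inv (inv g v)"
        using R[OF v, of y] v comm by simp
    qed
    then have "inv\<^bsub>BijGroup (carrier G)\<^esub> inner v = inv\<^bsub>BijGroup (carrier G)\<^esub> inner (g v)"
      using v by simp
    then show ?thesis using v by (metis I.H.inv_inv I.hom_closed g.hom_closed)
  qed
  show thesis by (rule that[OF f(1) g(1) e AB comm inner_f inner_g])
qed

end

section \<open>Homomorphisms from a quasigroup to a group\<close>

context quasigroup
begin

lemma mult_closed: "\<lbrakk>x \<in> carrier Q; y \<in> carrier Q\<rbrakk> \<Longrightarrow> x \<odot> y \<in> carrier Q"
  using left_translation bij_betwE by blast

lemma ldiv_eqI: "\<lbrakk>a \<in> carrier Q; x \<in> carrier Q; a \<odot> x = b\<rbrakk> \<Longrightarrow> ldiv Q a b = x"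
  unfolding ldiv_def using left_translation[of a]
  by (intro the_equality) (auto simp: bij_betw_def inj_on_def)

lemma rdiv_eqI: "\<lbrakk>a \<in> carrier Q; x \<in> carrier Q; x \<odot> a = b\<rbrakk> \<Longrightarrow> rdiv Q b a = x"
  unfolding rdiv_def using right_translation[of a]
  by (intro the_equality) (auto simp: bij_betw_def inj_on_def)

lemma ldiv:
  assumes "a \<in> carrier Q" "b \<in> carrier Q"
  shows "ldiv Q a b \<in> carrier Q" "a \<odot> ldiv Q a b = b"
proof -
  obtain x where "x \<in> carrier Q" "a \<odot> x = b"
    using left_translation[OF assms(1)] assms(2) by (metis bij_betw_imp_surj_on imageE)
  then show "ldiv Q a b \<in> carrier Q" "a \<odot> ldiv Q a b = b"
    using ldiv_eqI assms by auto
qed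

lemma rdiv:
  assumes "a \<in> carrier Q" "b \<in> carrier Q"
  shows "rdiv Q b a \<in> carrier Q" "rdiv Q b a \<odot> a = b"
proof -
  obtain x where "x \<in> carrier Q" "x \<odot> a = b"
    using right_translation[OF assms(1)] assms(2) by (metis bij_betw_imp_surj_on imageE)
  then show "rdiv Q b a \<in> carrier Q" "rdiv Q b a \<odot> a = b"
    using rdiv_eqI assms by auto
qed

lemma alpha:
  assumes "x \<in> carrier Q" shows "alpha Q x \<in> carrier Q" "x \<odot> alpha Q x = x"
  using ldiv[OF assms assms] unfolding alpha_def ldiv_def by auto

lemma beta:
  assumes "x \<in> carrier Q" shows "beta Q x \<in> carrier Q" "beta Q x \<odot> x = x"
  using rdiv[OF assms assms] unfolding beta_def rdiv_def by auto

end

locale quasigroup_group_hom = quasigroup Q + H: group H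
  for Q :: "'a magma" (structure) and H :: "('b, 'c) monoid_scheme" +
  fixes r :: "'a \<Rightarrow> 'b"
  assumes r_closed: "x \<in> carrier Q \<Longrightarrow> r x \<in> carrier H"
    and r_mult: "\<lbrakk>x \<in> carrier Q; y \<in> carrier Q\<rbrakk> \<Longrightarrow> r (x \<odot> y) = r x \<otimes>\<^bsub>H\<^esub> r y"
begin

definition ker :: "'a set"
  where "ker = {a \<in> carrier Q. r a = \<one>\<^bsub>H\<^esub>}"

definition ker_rel :: "('a \<times> 'a) set"
  where "ker_rel = {(x, y). x \<in> carrier Q \<and> y \<in> carrier Q \<and> r x = r y}"

lemma r_ldiv:
  assumes "a \<in> carrier Q" "b \<in> carrier Q"
  shows "r (ldiv Q a b) = inv\<^bsub>H\<^esub> r a \<otimes>\<^bsub>H\<^esub> r b"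
proof -
  have "r a \<otimes>\<^bsub>H\<^esub> r (ldiv Q a b) = r b"
    using ldiv[OF assms] assms by (metis r_mult)
  then show ?thesis
    using assms ldiv(1)[OF assms] r_closed by (metis H.inv_solve_left)
qed

lemma r_rdiv:
  assumes "a \<in> carrier Q" "b \<in> carrier Q"
  shows "r (rdiv Q b a) = r b \<otimes>\<^bsub>H\<^esub> inv\<^bsub>H\<^esub> r a"
proof -
  have "r (rdiv Q b a) \<otimes>\<^bsub>H\<^esub> r a = r b"
    using rdiv[OF assms] assms by (metis r_mult)
  then show ?thesis
    using assms rdiv(1)[OF assms] r_closed by (metis H.inv_solve_right)
qed

text \<open>Applying \<open>r\<close> to \<open>x \<odot> \<alpha>(x) = x\<close> and cancelling in the group \<open>H\<close> shows \<open>r (\<alpha>(x)) = \<one>\<close>;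
  in particular the kernel is nonempty.\<close>

lemma alpha_in_ker: "x \<in> carrier Q \<Longrightarrow> alpha Q x \<in> ker"
  using alpha[of x] r_mult[of x "alpha Q x"] r_closed
  by (auto simp: ker_def)

lemma beta_in_ker: "x \<in> carrier Q \<Longrightarrow> beta Q x \<in> ker"
  using beta[of x] r_mult[of "beta Q x" x] r_closed
  by (auto simp: ker_def)

lemma ker_subquasigroup: "subquasigroup ker Q"
proof -
  have div: "ldiv Q a b \<in> ker" "rdiv Q b a \<in> ker" if "a \<in> ker" "b \<in> ker" for a b
    using that by (auto simp: ker_def ldiv rdiv r_ldiv r_rdiv)
  have mult: "a \<odot> b \<in> ker" if "a \<in> ker" "b \<in> ker" for a b
    using that by (auto simp: ker_def mult_closed r_mult)
  have sub: "ker \<subseteq> carrier Q" by (auto simp: ker_def)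
  have "quasigroup (Q\<lparr>carrier := ker\<rparr>)"
  proof
    show "carrier (Q\<lparr>carrier := ker\<rparr>) \<noteq> {}"
      using nonempty alpha_in_ker by auto
    fix a assume "a \<in> carrier (Q\<lparr>carrier := ker\<rparr>)"
    then have a: "a \<in> ker" by simp
    have "bij_betw (\<lambda>x. a \<odot> x) ker ker"
      by (rule bij_betw_byWitness[where f' = "ldiv Q a"])
        (use a div mult in \<open>auto simp: subsetD[OF sub] ldiv ldiv_eqI\<close>)
    then show "bij_betw (\<lambda>x. a \<odot>\<^bsub>Q\<lparr>carrier := ker\<rparr>\<^esub> x)
        (carrier (Q\<lparr>carrier := ker\<rparr>)) (carrier (Q\<lparr>carrier := ker\<rparr>))" by simp
    have "bij_betw (\<lambda>x. x \<odot> a) ker ker"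
      by (rule bij_betw_byWitness[where f' = "\<lambda>b. rdiv Q b a"])
        (use a div mult in \<open>auto simp: subsetD[OF sub] rdiv rdiv_eqI\<close>)
    then show "bij_betw (\<lambda>x. x \<odot>\<^bsub>Q\<lparr>carrier := ker\<rparr>\<^esub> a)
        (carrier (Q\<lparr>carrier := ker\<rparr>)) (carrier (Q\<lparr>carrier := ker\<rparr>))" by simp
  qed
  with sub show ?thesis by (simp add: subquasigroup_def)
qed

lemma equiv_ker_rel: "equiv (carrier Q) ker_rel"
  by (rule equivI) (auto simp: ker_rel_def refl_on_def sym_def trans_def)

lemma normal_congruence_ker_rel: "normal_congruence Q ker_rel"
  unfolding normal_congruence_def
  using equiv_ker_rel by (auto simp: ker_rel_def mult_closed ldiv rdiv r_mult r_ldiv r_rdiv)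

lemma ker_block:
  assumes "n \<in> ker"
  shows "ker = ker_rel `` {n}"
  using assms by (auto simp: ker_def ker_rel_def)

lemma ker_quotient: "ker \<in> carrier Q // ker_rel"
proof -
  obtain x where "x \<in> carrier Q" using nonempty by blast
  then show ?thesis
    using ker_block[of "alpha Q x"] alpha(1) alpha_in_ker quotientI by metis
qed

lemma ker_normal: "normal_subquasigroup ker Q"
  unfolding normal_subquasigroup_def
  using ker_subquasigroup normal_congruence_ker_rel ker_quotient by blast

text \<open>The class of \<open>x\<close> is determined by \<open>r x\<close>, so the group laws for classes are inherited
  from \<open>H\<close>; inverses come from division in the quasigroup.\<close>

lemma quotient_is_group: "is_group (quotient_quasigroup Q ker)"
proof -
  let ?cl = "\<lambda>x. ker_rel `` {x}"
  let ?P = "quotient_quasigroup Q ker"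
  have P: "?P = quotient_by Q ker_rel"
    unfolding quotient_quasigroup_def
    using congruence_of_eq[OF quasigroup_axioms normal_congruence_ker_rel ker_quotient] by simp
  have cl_eq: "?cl x = ?cl y \<longleftrightarrow> r x = r y" if "x \<in> carrier Q" "y \<in> carrier Q" for x y
    using that eq_equiv_class_iff[OF equiv_ker_rel] by (auto simp: ker_rel_def)
  have carr: "carrier ?P = ?cl ` carrier Q"
    by (auto simp: P quotient_by_def quotient_def)
  have mult: "?cl x \<odot>\<^bsub>?P\<^esub> ?cl y = ?cl (x \<odot> y)" if xy: "x \<in> carrier Q" "y \<in> carrier Q" for x y
  proof -
    have same: "?cl (x' \<odot> y') = ?cl (x \<odot> y)" if "x' \<in> ?cl x" "y' \<in> ?cl y" for x' y'
      using that xy by (auto simp: ker_rel_def mult_closed r_mult)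
    have ne: "?cl x \<noteq> {}" "?cl y \<noteq> {}" using xy by (auto simp: ker_rel_def)
    have "(\<Union>x'\<in>?cl x. \<Union>y'\<in>?cl y. ?cl (x' \<odot> y')) = ?cl (x \<odot> y)"
      by (intro SUP_eq_const ne same)
    then show ?thesis by (simp add: P quotient_by_def)
  qed
  obtain n where n: "n \<in> carrier Q" "r n = \<one>\<^bsub>H\<^esub>"
    using nonempty alpha_in_ker unfolding ker_def by blast
  have "group \<lparr>carrier = carrier ?P, monoid.mult = qmult ?P, one = ?cl n\<rparr>" (is "group ?K")
  proof (rule groupI)
    fix X Y assume "X \<in> carrier ?K" "Y \<in> carrier ?K"
    then show "X \<otimes>\<^bsub>?K\<^esub> Y \<in> carrier ?K" by (auto simp: carr mult mult_closed)
  next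
    show "\<one>\<^bsub>?K\<^esub> \<in> carrier ?K" using n by (simp add: carr)
  next
    fix X Y Z assume "X \<in> carrier ?K" "Y \<in> carrier ?K" "Z \<in> carrier ?K"
    then obtain x y z where "x \<in> carrier Q" "y \<in> carrier Q" "z \<in> carrier Q"
      "X = ?cl x" "Y = ?cl y" "Z = ?cl z" by (auto simp: carr)
    then show "X \<otimes>\<^bsub>?K\<^esub> Y \<otimes>\<^bsub>?K\<^esub> Z = X \<otimes>\<^bsub>?K\<^esub> (Y \<otimes>\<^bsub>?K\<^esub> Z)"
      by (simp add: mult mult_closed cl_eq r_mult r_closed H.m_assoc)
  next
    fix X assume "X \<in> carrier ?K"
    then obtain x where x: "x \<in> carrier Q" "X = ?cl x" by (auto simp: carr)
    then show "\<one>\<^bsub>?K\<^esub> \<otimes>\<^bsub>?K\<^esub> X = X"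
      using n by (simp add: mult mult_closed cl_eq r_mult r_closed)
    show "\<exists>Y\<in>carrier ?K. Y \<otimes>\<^bsub>?K\<^esub> X = \<one>\<^bsub>?K\<^esub>"
      using x n rdiv[OF x(1) n(1)] by (intro bexI[of _ "?cl (rdiv Q n x)"]) (auto simp: carr mult)
  qed
  then show ?thesis unfolding is_group_def by blast
qed

end

section \<open>FG-quasigroups\<close>

text \<open>The linear form of an FG-quasigroup. The witness required by the group version of the left
  (right) F-law at \<open>\<phi> x\<close> is the image of \<open>\<alpha>(x)\<close> (of \<open>\<beta>(x)\<close>).\<close>

lemma FG_quasigroup_form:
  fixes Q :: "'a magma" (structure)
  assumes "FG_quasigroup Q"
  obtains G :: "'a monoid" and \<phi> f g e where "group G"
    and "bij_betw \<phi> (carrier Q) (carrier G)"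
    and "f \<in> iso G G" "g \<in> iso G G" "e \<in> carrier G"
    and "\<And>x y. \<lbrakk>x \<in> carrier Q; y \<in> carrier Q\<rbrakk> \<Longrightarrow> \<phi> (x \<odot> y) = f (\<phi> x) \<otimes>\<^bsub>G\<^esub> e \<otimes>\<^bsub>G\<^esub> g (\<phi> y)"
    and "\<And>x. x \<in> carrier G \<Longrightarrow> f (g x) = g (f x)"
    and "\<And>x. x \<in> carrier G \<Longrightarrow> group.inner G (f x) = group.inner G x"
    and "\<And>x. x \<in> carrier G \<Longrightarrow> group.inner G (g x) = group.inner G x"
proof -
  interpret FG_quasigroup Q by fact
  obtain G :: "'a monoid" and a b \<phi> where G: "group G"
    and a: "bij_betw a (carrier Q) (carrier G)" and b: "bij_betw b (carrier Q) (carrier G)"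
    and \<phi>: "bij_betw \<phi> (carrier Q) (carrier G)"
    and iso: "\<And>x y. \<lbrakk>x \<in> carrier Q; y \<in> carrier Q\<rbrakk> \<Longrightarrow> \<phi> (x \<odot> y) = a x \<otimes>\<^bsub>G\<^esub> b y"
    using isotopic_group unfolding isotopic_to_def by blast
  interpret G: group G by fact
  define \<psi> where "\<psi> = the_inv_into (carrier Q) \<phi>"
  have \<psi>: "bij_betw \<psi> (carrier G) (carrier Q)"
    unfolding \<psi>_def using \<phi> by (rule bij_betw_the_inv_into)
  have \<psi>\<phi>: "\<psi> (\<phi> x) = x" if "x \<in> carrier Q" for x
    unfolding \<psi>_def using \<phi> that by (meson bij_betw_def the_inv_into_f_f)
  define A B where "A = a \<circ> \<psi>" and "B = b \<circ> \<psi>"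
  have A: "bij_betw A (carrier G) (carrier G)" and B: "bij_betw B (carrier G) (carrier G)"
    unfolding A_def B_def using \<psi> a b by (auto intro: bij_betw_trans)
  have AB: "A (\<phi> x) \<otimes>\<^bsub>G\<^esub> B (\<phi> y) = \<phi> (x \<odot> y)" if "x \<in> carrier Q" "y \<in> carrier Q" for x y
    using that by (simp add: A_def B_def \<psi>\<phi> iso)
  have \<phi>_in: "\<phi> x \<in> carrier G" if "x \<in> carrier Q" for x using \<phi> that bij_betwE by blast
  have surj: "carrier G = \<phi> ` carrier Q" using \<phi> by (simp add: bij_betw_def)
  have left: "\<exists>c\<in>carrier G. \<forall>y\<in>carrier G. \<forall>z\<in>carrier G.
      A x \<otimes>\<^bsub>G\<^esub> B (A y \<otimes>\<^bsub>G\<^esub> B z) = A (A x \<otimes>\<^bsub>G\<^esub> B y) \<otimes>\<^bsub>G\<^esub> B (A c \<otimes>\<^bsub>G\<^esub> B z)"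
    if x: "x \<in> carrier G" for x
  proof -
    obtain x' where x': "x' \<in> carrier Q" "x = \<phi> x'" using x surj by blast
    show ?thesis
      using x' alpha(1)[OF x'(1)]
      by (intro bexI[of _ "\<phi> (alpha Q x')"])
        (auto simp: surj AB mult_closed left_F[OF x'(1), symmetric])
  qed
  have right: "\<exists>c\<in>carrier G. \<forall>y\<in>carrier G. \<forall>z\<in>carrier G.
      A (A z \<otimes>\<^bsub>G\<^esub> B y) \<otimes>\<^bsub>G\<^esub> B x = A (A z \<otimes>\<^bsub>G\<^esub> B c) \<otimes>\<^bsub>G\<^esub> B (A y \<otimes>\<^bsub>G\<^esub> B x)"
    if x: "x \<in> carrier G" for x
  proof -
    obtain x' where x': "x' \<in> carrier Q" "x = \<phi> x'" using x surj by blast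
    show ?thesis
      using x' beta(1)[OF x'(1)]
      by (intro bexI[of _ "\<phi> (beta Q x')"])
        (auto simp: surj AB mult_closed right_F[OF x'(1), symmetric])
  qed
  show thesis
  proof (rule G.F_isotope_form[OF A B left right])
    fix f g e
    assume fge: "f \<in> iso G G" "g \<in> iso G G" "e \<in> carrier G"
      and form: "\<And>x y. \<lbrakk>x \<in> carrier G; y \<in> carrier G\<rbrakk> \<Longrightarrow> A x \<otimes>\<^bsub>G\<^esub> B y = f x \<otimes>\<^bsub>G\<^esub> e \<otimes>\<^bsub>G\<^esub> g y"
      and comm: "\<And>x. x \<in> carrier G \<Longrightarrow> f (g x) = g (f x)"
      and inner: "\<And>x. x \<in> carrier G \<Longrightarrow> G.inner (f x) = G.inner x"
        "\<And>x. x \<in> carrier G \<Longrightarrow> G.inner (g x) = G.inner x"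
    have "\<phi> (x \<odot> y) = f (\<phi> x) \<otimes>\<^bsub>G\<^esub> e \<otimes>\<^bsub>G\<^esub> g (\<phi> y)"
      if "x \<in> carrier Q" "y \<in> carrier Q" for x y
      using that by (simp add: AB[symmetric] form \<phi>_in)
    from that[OF G \<phi> fge this comm inner] show thesis .
  qed
qed

text \<open>The homomorphism sends \<open>x\<close> to the inner automorphism induced by \<open>e \<otimes> \<phi> x\<close>. It is
  multiplicative because the factor \<open>e\<close> that sits between \<open>f (\<phi> x)\<close> and \<open>g (\<phi> y)\<close> in
  \<open>\<phi> (x \<odot> y)\<close> is what the second argument needs, while \<open>f\<close> and \<open>g\<close> are invisible to inner
  automorphisms. Its kernel consists of the \<open>a\<close> with \<open>e \<otimes> \<phi> a\<close> central, and both
  exchange laws (with two and with three free elements) reduce to that condition.\<close>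

lemma FG_quasigroup_medial_elements:
  fixes Q :: "'a magma" (structure)
  assumes "FG_quasigroup Q"
  obtains H :: "('a \<Rightarrow> 'a) monoid" and r where "quasigroup_group_hom Q H r"
    and "M Q = quasigroup_group_hom.ker Q H r"
    and "M Q = {a \<in> carrier Q. \<forall>x\<in>carrier Q. \<forall>y\<in>carrier Q. \<forall>z\<in>carrier Q.
      (x \<odot> a) \<odot> (y \<odot> z) = (x \<odot> y) \<odot> (a \<odot> z)}"
proof -
  interpret FG_quasigroup Q by fact
  obtain G :: "'a monoid" and \<phi> f g e where G: "group G"
    and \<phi>: "bij_betw \<phi> (carrier Q) (carrier G)"
    and iso: "f \<in> iso G G" "g \<in> iso G G" and e: "e \<in> carrier G"
    and form: "\<And>x y. \<lbrakk>x \<in> carrier Q; y \<in> carrier Q\<rbrakk> \<Longrightarrow> \<phi> (x \<odot> y) = f (\<phi> x) \<otimes>\<^bsub>G\<^esub> e \<otimes>\<^bsub>G\<^esub> g (\<phi> y)"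
    and comm: "\<And>x. x \<in> carrier G \<Longrightarrow> f (g x) = g (f x)"
    and inner_fg: "\<And>x. x \<in> carrier G \<Longrightarrow> group.inner G (f x) = group.inner G x"
      "\<And>x. x \<in> carrier G \<Longrightarrow> group.inner G (g x) = group.inner G x"
    using FG_quasigroup_form[OF assms] by blast
  interpret G: group G by fact
  let ?H = "BijGroup (carrier G)"
  interpret I: group_hom G ?H G.inner by (rule G.inner_hom)
  interpret f: group_hom G G f by unfold_locales (use iso in \<open>simp add: iso_def\<close>)
  interpret g: group_hom G G g by unfold_locales (use iso in \<open>simp add: iso_def\<close>)
  have \<phi>_in: "\<phi> x \<in> carrier G" if "x \<in> carrier Q" for x using \<phi> that bij_betwE by blast
  have \<phi>_eq: "\<phi> x = \<phi> y \<longleftrightarrow> x = y" if "x \<in> carrier Q" "y \<in> carrier Q" for x y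
    using \<phi> that by (auto simp: bij_betw_def inj_on_def)
  define r where "r = (\<lambda>x. G.inner (e \<otimes>\<^bsub>G\<^esub> \<phi> x))"
  interpret hom: quasigroup_group_hom Q ?H r
    by unfold_locales
      (simp_all add: r_def e \<phi>_in form inner_fg I.H.m_assoc)

  have exchange: "(x \<odot> a) \<odot> (y \<odot> z) = (x \<odot> y) \<odot> (a \<odot> z) \<longleftrightarrow>
      f (g (\<phi> a)) \<otimes>\<^bsub>G\<^esub> e \<otimes>\<^bsub>G\<^esub> f (g (\<phi> y)) = f (g (\<phi> y)) \<otimes>\<^bsub>G\<^esub> e \<otimes>\<^bsub>G\<^esub> f (g (\<phi> a))"
    if Q: "x \<in> carrier Q" "a \<in> carrier Q" "y \<in> carrier Q" "z \<in> carrier Q" for x a y z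
  proof -
    \<comment> \<open>\<open>?p\<close> depends only on \<open>x\<close> and \<open>?q\<close> only on \<open>z\<close>; commutation of \<open>f\<close> and \<open>g\<close> makes the middle
      part symmetric in form under exchange of \<open>a\<close> and \<open>y\<close>.\<close>
    let ?p = "f (f (\<phi> x)) \<otimes>\<^bsub>G\<^esub> f e" and ?q = "g e \<otimes>\<^bsub>G\<^esub> g (g (\<phi> z))"
    let ?s = "\<lambda>a y. f (g (\<phi> a)) \<otimes>\<^bsub>G\<^esub> e \<otimes>\<^bsub>G\<^esub> f (g (\<phi> y))"
    have pq: "?p \<in> carrier G" "?q \<in> carrier G" "?s a y \<in> carrier G" "?s y a \<in> carrier G"
      using Q e by (simp_all add: \<phi>_in)
    have expand: "\<phi> ((x \<odot> a) \<odot> (y \<odot> z)) = ?p \<otimes>\<^bsub>G\<^esub> ?s a y \<otimes>\<^bsub>G\<^esub> ?q"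
      if "a \<in> carrier Q" "y \<in> carrier Q" for a y
      using that Q e by (simp add: form mult_closed \<phi>_in comm G.m_assoc)
    have "(x \<odot> a) \<odot> (y \<odot> z) = (x \<odot> y) \<odot> (a \<odot> z) \<longleftrightarrow>
        \<phi> ((x \<odot> a) \<odot> (y \<odot> z)) = \<phi> ((x \<odot> y) \<odot> (a \<odot> z))"
      using Q by (simp add: \<phi>_eq mult_closed)
    also have "\<dots> \<longleftrightarrow> ?p \<otimes>\<^bsub>G\<^esub> ?s a y \<otimes>\<^bsub>G\<^esub> ?q = ?p \<otimes>\<^bsub>G\<^esub> ?s y a \<otimes>\<^bsub>G\<^esub> ?q"
      using Q by (simp only: expand)
    also have "\<dots> \<longleftrightarrow> ?s a y = ?s y a"
      using pq by (simp add: G.m_assoc[of ?p])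
    finally show ?thesis .
  qed
  have fg_surj: "\<exists>y\<in>carrier Q. u = f (g (\<phi> y))" if "u \<in> carrier G" for u
    using iso \<phi> that by (metis (no_types, lifting) bij_betw_imp_surj_on imageE iso_def mem_Collect_eq)
  have central: "(\<forall>y\<in>carrier Q. f (g (\<phi> a)) \<otimes>\<^bsub>G\<^esub> e \<otimes>\<^bsub>G\<^esub> f (g (\<phi> y)) =
      f (g (\<phi> y)) \<otimes>\<^bsub>G\<^esub> e \<otimes>\<^bsub>G\<^esub> f (g (\<phi> a))) \<longleftrightarrow> a \<in> hom.ker"
    if a: "a \<in> carrier Q" for a
  proof -
    \<comment> \<open>Taking \<open>u = \<one>\<close> in \<open>k \<otimes> e \<otimes> u = u \<otimes> e \<otimes> k\<close> shows that \<open>k\<close> and \<open>e\<close> commute; conversely,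
      if \<open>e \<otimes> k\<close> is central then it commutes with \<open>e\<close>, hence so does \<open>k\<close>.\<close>
    define k where "k = f (g (\<phi> a))"
    have k: "k \<in> carrier G" using a by (simp add: k_def \<phi>_in)
    have "(\<forall>y\<in>carrier Q. k \<otimes>\<^bsub>G\<^esub> e \<otimes>\<^bsub>G\<^esub> f (g (\<phi> y)) = f (g (\<phi> y)) \<otimes>\<^bsub>G\<^esub> e \<otimes>\<^bsub>G\<^esub> k) \<longleftrightarrow>
        (\<forall>u\<in>carrier G. k \<otimes>\<^bsub>G\<^esub> e \<otimes>\<^bsub>G\<^esub> u = u \<otimes>\<^bsub>G\<^esub> e \<otimes>\<^bsub>G\<^esub> k)"
      using fg_surj by (metis \<phi>_in f.hom_closed g.hom_closed)
    also have "\<dots> \<longleftrightarrow> (\<forall>u\<in>carrier G. (e \<otimes>\<^bsub>G\<^esub> k) \<otimes>\<^bsub>G\<^esub> u = u \<otimes>\<^bsub>G\<^esub> (e \<otimes>\<^bsub>G\<^esub> k))" (is "?l \<longleftrightarrow> ?r")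
    proof
      assume l: ?l
      have "k \<otimes>\<^bsub>G\<^esub> e = e \<otimes>\<^bsub>G\<^esub> k" using bspec[OF l G.one_closed] k e by simp
      then show ?r using l k e by (simp add: G.m_assoc)
    next
      assume r: ?r
      have "e \<otimes>\<^bsub>G\<^esub> (k \<otimes>\<^bsub>G\<^esub> e) = e \<otimes>\<^bsub>G\<^esub> (e \<otimes>\<^bsub>G\<^esub> k)" using bspec[OF r e] k e by (simp add: G.m_assoc)
      then have "k \<otimes>\<^bsub>G\<^esub> e = e \<otimes>\<^bsub>G\<^esub> k" using k e by simp
      then show ?l using r k e by (simp add: G.m_assoc)
    qed
    also have "\<dots> \<longleftrightarrow> G.inner (e \<otimes>\<^bsub>G\<^esub> k) = \<one>\<^bsub>?H\<^esub>"
      using k e by (simp only: G.inner_eq_one_iff G.m_closed)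
    also have "\<dots> \<longleftrightarrow> r a = \<one>\<^bsub>?H\<^esub>"
      using a e by (simp add: k_def r_def inner_fg \<phi>_in)
    finally show ?thesis using a by (simp add: k_def hom.ker_def)
  qed
  have ex: "\<exists>x. x \<in> carrier Q" using nonempty by blast
  have two: "(\<forall>x\<in>carrier Q. \<forall>y\<in>carrier Q. (x \<odot> a) \<odot> (y \<odot> x) = (x \<odot> y) \<odot> (a \<odot> x)) \<longleftrightarrow> a \<in> hom.ker"
    if "a \<in> carrier Q" for a
    unfolding central[OF that, symmetric] using that ex by (simp add: exchange)
  have three: "(\<forall>x\<in>carrier Q. \<forall>y\<in>carrier Q. \<forall>z\<in>carrier Q.
      (x \<odot> a) \<odot> (y \<odot> z) = (x \<odot> y) \<odot> (a \<odot> z)) \<longleftrightarrow> a \<in> hom.ker"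
    if "a \<in> carrier Q" for a
    unfolding central[OF that, symmetric] using that ex by (simp add: exchange)
  have sub: "hom.ker \<subseteq> carrier Q" by (auto simp: hom.ker_def)
  show thesis
  proof (rule that)
    show "quasigroup_group_hom Q ?H r" by (rule hom.quasigroup_group_hom_axioms)
    show M_ker: "M Q = hom.ker"
      unfolding M_def using two sub by blast
    show "M Q = {a \<in> carrier Q. \<forall>x\<in>carrier Q. \<forall>y\<in>carrier Q. \<forall>z\<in>carrier Q.
      (x \<odot> a) \<odot> (y \<odot> z) = (x \<odot> y) \<odot> (a \<odot> z)}"
      unfolding M_ker using three sub by blast
  qed
qed

theorem proposition5p6:
  fixes Q :: "'a magma" (structure)
  assumes "FG_quasigroup Q"
  shows "alpha Q ` carrier Q \<union> beta Q ` carrier Q \<subseteq> M Q \<and>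
    M Q = {a \<in> carrier Q. \<forall>x\<in>carrier Q. \<forall>y\<in>carrier Q. \<forall>z\<in>carrier Q.
      (x \<odot> a) \<odot> (y \<odot> z) = (x \<odot> y) \<odot> (a \<odot> z)} \<and>
    medial (Q\<lparr>carrier := M Q\<rparr>) \<and>
    normal_subquasigroup (M Q) Q \<and>
    is_group (quotient_quasigroup Q (M Q))"
proof -
  obtain H :: "('a \<Rightarrow> 'a) monoid" and r where hom: "quasigroup_group_hom Q H r"
    and M_ker: "M Q = quasigroup_group_hom.ker Q H r"
    and M_eq: "M Q = {a \<in> carrier Q. \<forall>x\<in>carrier Q. \<forall>y\<in>carrier Q. \<forall>z\<in>carrier Q.
      (x \<odot> a) \<odot> (y \<odot> z) = (x \<odot> y) \<odot> (a \<odot> z)}"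
    using FG_quasigroup_medial_elements[OF assms] by blast
  interpret quasigroup_group_hom Q H r by (rule hom)
  have "alpha Q ` carrier Q \<union> beta Q ` carrier Q \<subseteq> M Q"
    unfolding M_ker using alpha_in_ker beta_in_ker by blast
  moreover have "medial (Q\<lparr>carrier := M Q\<rparr>)"
  proof -
    have "(x \<odot> a) \<odot> (b \<odot> y) = (x \<odot> b) \<odot> (a \<odot> y)"
      if "x \<in> M Q" "a \<in> M Q" "b \<in> M Q" "y \<in> M Q" for x a b y
      using that unfolding M_eq by blast
    then show ?thesis by (simp add: medial_def)
  qed
  moreover have "normal_subquasigroup (M Q) Q" "is_group (quotient_quasigroup Q (M Q))"
    unfolding M_ker by (rule ker_normal, rule quotient_is_group)
  ultimately show ?thesis using M_eq by blast
qed

end
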